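(* Let $\mathcal H,\mathcal K$ be real Hilbert spaces, $\mathrm K:\mathcal H\to\mathcal K$ a bounded linear operator, $\Xi,\mathcal Z$ Polish spaces, $(\mathsf m^p_x)_{x\in\mathcal H}$ and $(\mathsf m^d_y)_{y\in\mathcal K}$ families of probability measures on $\Xi$ and $\mathcal Z$, and let $\beta_f,\beta_r,L_f,L_r,\mu_p,\mu_d,\tau>0$. Assume: (a) $f\in C^1(\mathcal H\times\Xi)$; for every $x\in\mathcal H$, $f(x,\cdot)$ is $\mathsf m^p_x$-measurable and $\xi\mapsto\nabla f(x,\xi)$ is $\beta_f$-Lipschitz; $\nabla f(\cdot,\xi)$ is $L_f$-Lipschitz for every $\xi\in\Xi$; (b) $r\in C^1(\mathcal K\times\mathcal Z)$; for every $y\in\mathcal K$, $r(y,\cdot)$ is $\mathsf m^d_y$-measurable and $\zeta\mapsto\nabla r(y,\zeta)$ is $\beta_r$-Lipschitz; $\nabla r(\cdot,\zeta)$ is $L_r$-Lipschitz for every $\zeta\in\mathcal Z$; (c) $g\in\Gamma_0(\mathcal H)$ and $h\in\Gamma_0(\mathcal K)$ are continuously differentiable with Lipschitz continuous gradients; (d) $f_{\mathsf m^p_x}+g$ is $\mu_p$-strongly convex for all $x\in\mathcal H$ and $r_{\mathsf m^d_y}+h$ is $\mu_d$-strongly convex for all $y\in\mathcal K$; (e) $\mathbb W_1(\mathsf m^p_x\otimes\mathsf m^d_y,\mathsf m^p_{x'}\otimes\mathsf m^d_{y'})\le\tau\|(x,y)-(x',y')\|_{\mathcal H\times\mathcal K}$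 for all $x,x'\in\mathcal H$, $y,y'\in\mathcal K$. Let $\tilde\mu=\min(\mu_p,\mu_d)$, $\tilde\beta=\max(\beta_f,\beta_r)$, $\tilde\rho=\tau\tilde\beta/\tilde\mu$, and suppose $\tilde\rho<\frac{\sqrt2}{4}$. Let $\bar Z=(\bar x,\bar y)$ be the equilibrium, and let $Z(t)=(x(t),y(t))$, $t\in[t_0,\infty[$, be the solution of $$\ddot Z(t)+2\sqrt{\tilde\mu}\,\dot Z(t)+\begin{pmatrix}\nabla_x\mathcal L_{\mathsf m^p_{\bar x},\mathsf m^d_{\bar y}}\big(x(t),y(t)+\tfrac1{\sqrt{\tilde\mu}}\dot y(t)\big)\\-\nabla_y\mathcal L_{\mathsf m^p_{\bar x},\mathsf m^d_{\bar y}}\big(x(t)+\tfrac1{\sqrt{\tilde\mu}}\dot x(t),y(t)\big)\end{pmatrix}+\mathbf E_{\bar Z}(Z(t))=0 .$$ Then for all $t\ge t_0$, $$\frac{\tilde\mu}{2}\|Z(t)-\bar Z\|^2_{\mathcal H\times\mathcal K}\le\mathcal L_{\mathsf m^p_{\bar x},\mathsf m^d_{\bar y}}(x(t),\bar y)-\mathcal L_{\mathsf m^p_{\bar x},\mathsf m^d_{\bar y}}(\bar x,y(t))\le\mathcal V(t_0)e^{-\frac{\sqrt{\tilde\mu}}{4}(t-t_0)} .$$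
   Context: $\nabla f,\nabla r$ denote gradients with respect to the first variable. $\Gamma_0$: proper, lower semicontinuous, convex functions bounded below. $\mathcal H\times\mathcal K$ carries the product inner product and norm; $\Xi\times\mathcal Z$ carries the $\ell^2$ product metric. For probability measures $\mathsf m^p$ on $\Xi$, $\mathsf m^d$ on $\mathcal Z$: $f_{\mathsf m^p}(x)=\mathbb E_{\xi\sim\mathsf m^p}f(x,\xi)$, $r_{\mathsf m^d}(y)=\mathbb E_{\zeta\sim\mathsf m^d}r(y,\zeta)$ (expectations well defined, gradients taken under the expectation), and $$\mathcal L_{\mathsf m^p,\mathsf m^d}(x,y)=f_{\mathsf m^p}(x)+g(x)+\langle y,\mathrm Kx\rangle-h(y)-r_{\mathsf m^d}(y).$$ $\mathbb W_1(\mathsf m,\nu)=\sup_k|\mathbb E_{\mathsf m}k-\mathbb E_\nu k|$ over 1-Lipschitz real functions $k$. $\mu$-strong convexity of $G$ means $G-\frac\mu2\|\cdot\|^2$ is convex. The equilibrium $(\bar x,\bar y)$ satisfies $0\in\nabla f_{\mathsf m^p_{\bar x}}(\bar x)+\partial g(\bar x)+\mathrm K^*\bar y$ and $0\in\nabla r_{\mathsf m^d_{\bar y}}(\bar y)+\partial h(\bar y)-\mathrm K\bar x$ (it exists and is unique when $\tilde\rho<1$). The gap is $$\mathbf E_{\bar Z}(x,y)=\big(\nabla f_{\mathsf m^p_x}(x)-\nabla f_{\mathsf m^p_{\bar x}}(x),\ \nabla r_{\mathsf m^d_y}(y)-\nabla r_{\mathsf m^d_{\bar y}}(y)\big).$$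 A solution is $Z\in C^1([t_0,\infty[;\mathcal H\times\mathcal K)$ with $\dot Z$ locally absolutely continuous, satisfying the equation a.e. The energy is $$\mathcal V(t)=\mathcal L_{\mathsf m^p_{\bar x},\mathsf m^d_{\bar y}}(x(t),\bar y)-\mathcal L_{\mathsf m^p_{\bar x},\mathsf m^d_{\bar y}}(\bar x,y(t))+\tfrac12\|v(t)\|^2,\quad v(t)=\sqrt{\tilde\mu}(Z(t)-\bar Z)+\dot Z(t).$$ *)

theory Defs
  imports "HOL-Probability.Probability"
begin

definition gradient :: "('a::real_inner \<Rightarrow> real) \<Rightarrow> 'a \<Rightarrow> 'a" where
  "gradient F x = (THE D. GDERIV F x :> D)"

lemma gradient_eq:
  assumes "GDERIV F x :> D"
  shows "gradient F x = D"
  unfolding gradient_def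
proof (rule the_equality)
  show "GDERIV F x :> D" by (rule assms)
next
  fix D' assume "GDERIV F x :> D'"
  then have "(\<lambda>u. u \<bullet> D') = (\<lambda>u. u \<bullet> D)"
    using assms unfolding gderiv_def by (rule has_derivative_unique)
  then have "(D' - D) \<bullet> D' = (D' - D) \<bullet> D" by (rule fun_cong)
  then have "(D' - D) \<bullet> (D' - D) = 0" by (simp add: inner_diff_right)
  then show "D' = D" by simp
qed

definition grad1 :: "('a::real_inner \<Rightarrow> 's \<Rightarrow> real) \<Rightarrow> 'a \<Rightarrow> 's \<Rightarrow> 'a" where
  "grad1 F x s = gradient (\<lambda>z. F z s) x"

definition C1 :: "('a::real_inner \<Rightarrow> real) \<Rightarrow> bool" where
  "C1 F \<longleftrightarrow> (\<forall>x. \<exists>D. GDERIV F x :> D) \<and> continuous_on UNIV (gradient F)"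

text \<open>The parameter space is only a metric space, so \<open>C\<^sup>1\<close> on the product means: jointly
  continuous, differentiable in the first variable, with jointly continuous partial gradient.\<close>

definition C1_param :: "('a::real_inner \<Rightarrow> 's::metric_space \<Rightarrow> real) \<Rightarrow> bool" where
  "C1_param F \<longleftrightarrow>
     continuous_on UNIV (\<lambda>(x, s). F x s) \<and>
     (\<forall>x s. \<exists>D. GDERIV (\<lambda>z. F z s) x :> D) \<and>
     continuous_on UNIV (\<lambda>(x, s). grad1 F x s)"

definition strongly_convex :: "real \<Rightarrow> ('a::real_inner \<Rightarrow> real) \<Rightarrow> bool" where
  "strongly_convex \<mu> G \<longleftrightarrow> convex_on UNIV (\<lambda>x. G x - \<mu> / 2 * (norm x)\<^sup>2)"

text \<open>In the convexity inequality the products and sums are unambiguous, since a member never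
  takes the value \<open>-\<infinity>\<close> and \<open>0 * \<infinity> = 0\<close> in \<^typ>\<open>ereal\<close>.\<close>

definition Gamma0 :: "('a::real_inner \<Rightarrow> ereal) set" where
  "Gamma0 = {F.
     (\<exists>x. F x \<noteq> \<infinity>) \<and> (\<forall>x. F x \<noteq> -\<infinity>) \<and>
     (\<forall>x. F x \<le> Liminf (at x) F) \<and>
     (\<forall>x y. \<forall>t\<in>{0..1}. F ((1 - t) *\<^sub>R x + t *\<^sub>R y) \<le> ereal (1 - t) * F x + ereal t * F y) \<and>
     (\<exists>c::real. \<forall>x. ereal c \<le> F x)}"

definition subdifferential :: "('a::real_inner \<Rightarrow> ereal) \<Rightarrow> 'a \<Rightarrow> 'a set" where
  "subdifferential F x = {p. \<forall>y. F x + ereal (p \<bullet> (y - x)) \<le> F y}"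

definition expected :: "('a \<Rightarrow> 's \<Rightarrow> real) \<Rightarrow> 's measure \<Rightarrow> 'a \<Rightarrow> real" where
  "expected F m x = (\<integral>s. F x s \<partial>m)"

text \<open>Vector-valued expectation, tested against all directions. The library's Bochner integral
  needs a second-countable target space, which the Hilbert spaces here need not be.\<close>

definition has_expectation :: "'s measure \<Rightarrow> ('s \<Rightarrow> 'a::real_inner) \<Rightarrow> 'a \<Rightarrow> bool" where
  "has_expectation m G v \<longleftrightarrow>
     (\<forall>u. integrable m (\<lambda>s. G s \<bullet> u) \<and> v \<bullet> u = (\<integral>s. G s \<bullet> u \<partial>m))"

definition expectations_well_defined ::
    "('a::real_inner \<Rightarrow> 's \<Rightarrow> real) \<Rightarrow> ('a \<Rightarrow> 's measure) \<Rightarrow> bool" where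
  "expectations_well_defined F M \<longleftrightarrow>
     (\<forall>x x'. integrable (M x') (F x) \<and>
        (\<exists>v. GDERIV (expected F (M x')) x :> v \<and> has_expectation (M x') (grad1 F x) v))"

text \<open>The supremum is over the 1-Lipschitz functions whose two expectations exist: without
  moment assumptions the integral of a non-integrable function would be the default value 0.\<close>

definition W1 :: "'a::metric_space measure \<Rightarrow> 'a measure \<Rightarrow> ereal" where
  "W1 m \<nu> = (SUP k \<in> {k :: 'a \<Rightarrow> real. 1-lipschitz_on UNIV k \<and> integrable m k \<and> integrable \<nu> k}.
     ereal \<bar>(\<integral>s. k s \<partial>m) - (\<integral>s. k s \<partial>\<nu>)\<bar>)"

definition lagrangian ::
    "('h::real_inner \<Rightarrow> 'a \<Rightarrow> real) \<Rightarrow> ('h \<Rightarrow> real) \<Rightarrow> ('h \<Rightarrow> 'k::real_inner) \<Rightarrow> ('k \<Rightarrow> real) \<Rightarrow>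
     ('k \<Rightarrow> 'b \<Rightarrow> real) \<Rightarrow> 'a measure \<Rightarrow> 'b measure \<Rightarrow> 'h \<Rightarrow> 'k \<Rightarrow> real" where
  "lagrangian f g K h r mp md x y = expected f mp x + g x + y \<bullet> K x - h y - expected r md y"

definition is_equilibrium ::
    "('h::real_inner \<Rightarrow> 'a \<Rightarrow> real) \<Rightarrow> ('h \<Rightarrow> real) \<Rightarrow> ('h \<Rightarrow> 'k::real_inner) \<Rightarrow> ('k \<Rightarrow> real) \<Rightarrow>
     ('k \<Rightarrow> 'b \<Rightarrow> real) \<Rightarrow> ('h \<Rightarrow> 'a measure) \<Rightarrow> ('k \<Rightarrow> 'b measure) \<Rightarrow> 'h \<times> 'k \<Rightarrow> bool" where
  "is_equilibrium f g K h r mp md = (\<lambda>(x, y).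
     0 \<in> {gradient (expected f (mp x)) x + p + adjoint K y | p.
            p \<in> subdifferential (\<lambda>z. ereal (g z)) x} \<and>
     0 \<in> {gradient (expected r (md y)) y + q - K x | q.
            q \<in> subdifferential (\<lambda>z. ereal (h z)) y})"

definition gap ::
    "('h::real_inner \<Rightarrow> 'a \<Rightarrow> real) \<Rightarrow> ('k::real_inner \<Rightarrow> 'b \<Rightarrow> real) \<Rightarrow> ('h \<Rightarrow> 'a measure) \<Rightarrow>
     ('k \<Rightarrow> 'b measure) \<Rightarrow> 'h \<times> 'k \<Rightarrow> 'h \<times> 'k \<Rightarrow> 'h \<times> 'k" where
  "gap f r mp md Zbar = (\<lambda>(x, y).
     (gradient (expected f (mp x)) x - gradient (expected f (mp (fst Zbar))) x,
      gradient (expected r (md y)) y - gradient (expected r (md (snd Zbar))) y))"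

definition abs_cont_on :: "real set \<Rightarrow> (real \<Rightarrow> 'a::real_normed_vector) \<Rightarrow> bool" where
  "abs_cont_on S F \<longleftrightarrow>
     (\<forall>\<epsilon>>0. \<exists>\<delta>>0. \<forall>D T. D division_of T \<and> T \<subseteq> S \<and> (\<Sum>I\<in>D. Sup I - Inf I) < \<delta> \<longrightarrow>
        (\<Sum>I\<in>D. norm (F (Sup I) - F (Inf I))) < \<epsilon>)"

definition velocity :: "real \<Rightarrow> (real \<Rightarrow> 'a::real_normed_vector) \<Rightarrow> real \<Rightarrow> 'a" where
  "velocity t0 Z t = vector_derivative Z (at t within {t0..})"

definition is_solution ::
    "real \<Rightarrow> ('h::real_inner \<Rightarrow> 'k::real_inner \<Rightarrow> real) \<Rightarrow> ('h \<times> 'k \<Rightarrow> 'h \<times> 'k) \<Rightarrow> real \<Rightarrow>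
     (real \<Rightarrow> 'h \<times> 'k) \<Rightarrow> bool" where
  "is_solution \<mu> L E t0 Z \<longleftrightarrow>
     (\<forall>t\<ge>t0. Z differentiable (at t within {t0..})) \<and>
     continuous_on {t0..} (velocity t0 Z) \<and>
     (\<forall>a b. {a..b} \<subseteq> {t0..} \<longrightarrow> abs_cont_on {a..b} (velocity t0 Z)) \<and>
     (AE t in lebesgue. t \<ge> t0 \<longrightarrow>
        (let x = fst (Z t); y = snd (Z t);
             x' = fst (velocity t0 Z t); y' = snd (velocity t0 Z t)
         in \<exists>A. (velocity t0 Z has_vector_derivative A) (at t within {t0..}) \<and>
              A + (2 * sqrt \<mu>) *\<^sub>R velocity t0 Z t
                + (gradient (\<lambda>u. L u (y + (1 / sqrt \<mu>) *\<^sub>R y')) x,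
                   - gradient (\<lambda>w. L (x + (1 / sqrt \<mu>) *\<^sub>R x') w) y)
                + E (Z t) = 0))"

definition energy ::
    "real \<Rightarrow> ('h::real_inner \<Rightarrow> 'k::real_inner \<Rightarrow> real) \<Rightarrow> 'h \<times> 'k \<Rightarrow> real \<Rightarrow>
     (real \<Rightarrow> 'h \<times> 'k) \<Rightarrow> real \<Rightarrow> real" where
  "energy \<mu> L Zbar t0 Z t =
     L (fst (Z t)) (snd Zbar) - L (fst Zbar) (snd (Z t))
     + 1 / 2 * (norm (sqrt \<mu> *\<^sub>R (Z t - Zbar) + velocity t0 Z t))\<^sup>2"

end

theory Submission
  imports Defs
begin

text \<open>
  Along a solution the energy satisfies \<open>V' \<le> - (1 - \<rho>) * sqrt \<mu> * V\<close>. In \<open>V'\<close> the coupling terms at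
  the extrapolated points contribute nothing, being skew in \<open>v\<close>; strong convexity controls the
  gradient terms; and the gap is at most \<open>\<rho> * \<mu> * norm (Z - Zbar)\<close>, by testing the Wasserstein
  distance with the components of the gradients. Since the forcing terms of the equation are
  continuous in \<open>t\<close>, absolute continuity of the velocity makes the equation hold everywhere, so
  \<open>V\<close> can be differentiated at every point.
\<close>

text \<open>The step \<open>1 / sqrt \<mu>\<close> of the extrapolation is what makes the coupling
  skew: since \<open>v = sqrt \<mu> *\<^sub>R (Z - Zbar) + Z'\<close>, the extrapolated point is the
  equilibrium plus \<open>v / sqrt \<mu>\<close>. The coupling therefore splits into its value at
  the equilibrium, which joins the gradient terms, and a skew operator applied to \<open>v\<close>.
  The rate \<open>1 / 4\<close> is a lower bound for \<open>1 - \<rho>\<close>, because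
  \<open>\<rho> < sqrt 2 / 4\<close> implies \<open>\<rho> \<le> 3 / 4\<close>. The factor \<rho> is
  not enlarged by having two components: each component of the gap is bounded by the displacement of
  that component alone, by varying one factor of the product measure at a time. The obstacle is that
  the equation holds only almost everywhere, for curves in Hilbert spaces that need not be
  separable. The velocity is therefore never recovered as a vector-valued integral; a mean value
  inequality in norm, with a constant reference vector \<open>c\<close>, takes the place of the
  fundamental theorem of calculus.\<close>

section \<open>Absolutely continuous curves\<close>

lemma has_vector_derivative_within_alt:
  fixes u :: "real \<Rightarrow> 'a::real_normed_vector"
  shows "(u has_vector_derivative A) (at t within S) \<longleftrightarrow>
    (\<forall>e>0. \<exists>d>0. \<forall>s\<in>S. \<bar>s - t\<bar> < d \<longrightarrow> norm (u s - u t - (s - t) *\<^sub>R A) \<le> e * \<bar>s - t\<bar>)"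
  unfolding has_vector_derivative_def has_derivative_within_alt
  by (auto simp: bounded_linear_scaleR_left)

text \<open>The straddle lemma: as the tag lies between the endpoints, the two one-sided errors add
  up to exactly the length \<open>w - v\<close>.\<close>

lemma increment_between:
  fixes u :: "real \<Rightarrow> 'a::real_normed_vector"
  assumes near: "\<And>s. s \<in> {v..w} \<Longrightarrow> norm (u s - u t - (s - t) *\<^sub>R c) \<le> e * \<bar>s - t\<bar>"
    and t: "t \<in> {v..w}"
  shows "norm (u w - u v - (w - v) *\<^sub>R c) \<le> e * (w - v)"
proof -
  have "u w - u v - (w - v) *\<^sub>R c = (u w - u t - (w - t) *\<^sub>R c) - (u v - u t - (v - t) *\<^sub>R c)"
    by (simp add: algebra_simps)
  then have "norm (u w - u v - (w - v) *\<^sub>R c)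
      \<le> norm (u w - u t - (w - t) *\<^sub>R c) + norm (u v - u t - (v - t) *\<^sub>R c)"
    by (metis norm_triangle_ineq4)
  also have "\<dots> \<le> e * \<bar>w - t\<bar> + e * \<bar>v - t\<bar>"
    using t by (intro add_mono near) auto
  also have "\<dots> = e * (w - v)"
    using t by (simp add: algebra_simps)
  finally show ?thesis .
qed

text \<open>Links the lengths in \<open>abs_cont_on\<close> to Lebesgue measure, by which the
  exceptional intervals are controlled.\<close>

lemma division_sum_length:
  fixes D :: "real set set"
  assumes "D division_of T"
  shows "(\<Sum>I\<in>D. Sup I - Inf I) = measure lebesgue T"
proof -
  have "(\<Sum>I\<in>D. Sup I - Inf I) = (\<Sum>I\<in>D. measure lebesgue I)"
  proof (rule sum.cong[OF refl])
    fix I assume "I \<in> D"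
    then obtain v w where I: "I = {v..w}" "I \<noteq> {}"
      using division_ofD(3,4)[OF assms] by (metis box_real(2))
    then show "Sup I - Inf I = measure lebesgue I"
      by auto
  qed
  then show ?thesis
    using content_division[OF assms] by simp
qed

text \<open>A mean value inequality, by Cousin's lemma: on a fine tagged division, the tags in the
  exceptional null set have intervals of small total length, where absolute continuity applies.\<close>

lemma abs_cont_on_norm_diff_le:
  fixes u :: "real \<Rightarrow> 'a::real_normed_vector"
  assumes ac: "abs_cont_on {a..b} u" and ab: "a \<le> b" and M: "0 \<le> M"
    and ae: "AE t in lebesgue. t \<in> {a..b} \<longrightarrow>
      (\<exists>A. (u has_vector_derivative A) (at t within {a..b}) \<and> norm (A - c) \<le> M)"
  shows "norm (u b - u a - (b - a) *\<^sub>R c) \<le> M * (b - a)"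
proof (rule field_le_epsilon)
  fix e :: real assume "0 < e"
  \<comment> \<open>The budget: \<open>\<eta> * (b - a)\<close> for tags outside the null set, and
    on the intervals tagged in it one \<eta> for the increments of \<open>u\<close> and one for the
    linear part in \<open>c\<close>.\<close>
  define \<eta> where "\<eta> = e / (b - a + 2)"
  have \<eta>: "0 < \<eta>" "\<eta> * (b - a + 2) = e"
    using \<open>0 < e\<close> ab by (auto simp: \<eta>_def)
  obtain \<delta>' where "\<delta>' > 0" and \<delta>': "\<And>D T. D division_of T \<Longrightarrow> T \<subseteq> {a..b} \<Longrightarrow>
      (\<Sum>I\<in>D. Sup I - Inf I) < \<delta>' \<Longrightarrow> (\<Sum>I\<in>D. norm (u (Sup I) - u (Inf I))) < \<eta>"
    using ac \<eta>(1) unfolding abs_cont_on_def by meson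
  \<comment> \<open>The second bound keeps the linear part below \<eta> on a set of measure
    \<delta>; the \<open>+ 1\<close> covers \<open>c = 0\<close>.\<close>
  define \<delta> where "\<delta> = min \<delta>' (\<eta> / (norm c + 1))"
  have \<delta>: "0 < \<delta>" "\<delta> \<le> \<delta>'" "\<delta> * norm c \<le> \<eta>"
  proof -
    show "0 < \<delta>" "\<delta> \<le> \<delta>'" using \<open>\<delta>' > 0\<close> \<eta> by (auto simp: \<delta>_def intro!: divide_pos_pos add_nonneg_pos)
    have "\<delta> * norm c \<le> \<delta> * (norm c + 1)" using \<open>0 < \<delta>\<close> by simp
    also have "\<dots> \<le> \<eta> / (norm c + 1) * (norm c + 1)"
      by (intro mult_right_mono) (auto simp: \<delta>_def)
    also have "\<dots> = \<eta>" by (simp add: add_nonneg_eq_0_iff)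
    finally show "\<delta> * norm c \<le> \<eta>" .
  qed
  obtain N where N: "N \<in> null_sets lebesgue" and good: "\<And>t. t \<in> {a..b} \<Longrightarrow> t \<notin> N \<Longrightarrow>
      \<exists>A. (u has_vector_derivative A) (at t within {a..b}) \<and> norm (A - c) \<le> M"
    by (rule AE_E3[OF ae]) (use that in \<open>auto simp del: atLeastAtMost_iff\<close>)
  obtain U where U: "open U" "N \<subseteq> U" "U - N \<in> lmeasurable" "emeasure lebesgue (U - N) < ennreal \<delta>"
    using sets_lebesgue_outer_open[of N \<delta>] N \<delta>(1) by (auto simp: null_sets_def)
  have Um: "U \<in> lmeasurable" and U\<delta>: "measure lebesgue U < \<delta>"
  proof -
    have "emeasure lebesgue U = emeasure lebesgue (U - N)"
      using N U(1) by (simp add: emeasure_Diff_null_set borel_open)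
    then have *: "emeasure lebesgue U < ennreal \<delta>" using U(4) by simp
    show "U \<in> lmeasurable"
      using * U(1) by (intro fmeasurableI) (auto simp: borel_open intro: less_top_ennreal order.strict_trans)
    show "measure lebesgue U < \<delta>"
      using * \<delta>(1) \<open>U \<in> lmeasurable\<close> by (simp add: emeasure_eq_measure2 ennreal_less_iff)
  qed
  have "\<exists>d>0. \<forall>s\<in>{a..b}. \<bar>s - t\<bar> < d \<longrightarrow> norm (u s - u t - (s - t) *\<^sub>R c) \<le> (M + \<eta>) * \<bar>s - t\<bar>"
    if t: "t \<in> {a..b}" "t \<notin> N" for t
  proof -
    obtain A where A: "(u has_vector_derivative A) (at t within {a..b})" "norm (A - c) \<le> M"
      using good[OF t] by blast
    obtain d where "d > 0" and d: "\<And>s. s \<in> {a..b} \<Longrightarrow> \<bar>s - t\<bar> < d \<Longrightarrow>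
        norm (u s - u t - (s - t) *\<^sub>R A) \<le> \<eta> * \<bar>s - t\<bar>"
      using A(1) \<eta>(1) unfolding has_vector_derivative_within_alt by meson
    have "norm (u s - u t - (s - t) *\<^sub>R c) \<le> (M + \<eta>) * \<bar>s - t\<bar>"
      if s: "s \<in> {a..b}" "\<bar>s - t\<bar> < d" for s
    proof -
      have "norm (u s - u t - (s - t) *\<^sub>R c)
          = norm ((u s - u t - (s - t) *\<^sub>R A) + (s - t) *\<^sub>R (A - c))"
        by (simp add: algebra_simps)
      also have "\<dots> \<le> norm (u s - u t - (s - t) *\<^sub>R A) + \<bar>s - t\<bar> * norm (A - c)"
        by (metis norm_scaleR norm_triangle_ineq)
      also have "\<dots> \<le> \<eta> * \<bar>s - t\<bar> + \<bar>s - t\<bar> * M"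
        using d[OF s] A(2) by (intro add_mono mult_left_mono) auto
      finally show ?thesis by (simp add: algebra_simps)
    qed
    with \<open>d > 0\<close> show ?thesis by blast
  qed
  then obtain d where dpos: "\<And>t. t \<in> {a..b} \<Longrightarrow> t \<notin> N \<Longrightarrow> d t > 0"
    and d: "\<And>t s. t \<in> {a..b} \<Longrightarrow> t \<notin> N \<Longrightarrow> s \<in> {a..b} \<Longrightarrow> \<bar>s - t\<bar> < d t \<Longrightarrow>
      norm (u s - u t - (s - t) *\<^sub>R c) \<le> (M + \<eta>) * \<bar>s - t\<bar>"
    by metis
  \<comment> \<open>Intervals tagged in \<open>N\<close> are confined to \<open>U\<close>, so their
    total length is below \<delta>; the others stay where the difference quotient is already close
    to \<open>c\<close>. The last case only makes \<gamma> total.\<close>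
  define \<gamma> where "\<gamma> t = (if t \<in> N then U else if t \<in> {a..b} then ball t (d t) else UNIV)" for t
  have "gauge \<gamma>"
    using U(1,2) dpos by (auto simp: gauge_def \<gamma>_def)
  then obtain p where p: "p tagged_division_of {a..b}" and fine: "\<gamma> fine p"
    using fine_division_exists_real by blast
  note pD = tagged_division_ofD[OF p]
  define w where "w I = u (Sup I) - u (Inf I) - (Sup I - Inf I) *\<^sub>R c" for I
  have box: "\<exists>v w. K = {v..w} \<and> v \<le> x \<and> x \<le> w \<and> a \<le> v \<and> w \<le> b" if "(x, K) \<in> p" for x K
    using pD(2,3,4)[OF that] by (metis atLeastAtMost_iff atLeastatMost_subset_iff box_real(2) order_trans)
  have len: "0 \<le> Sup K - Inf K" if "(x, K) \<in> p" for x K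
    using box[OF that] by auto
  define p1 where "p1 = {(x, K) \<in> p. x \<in> N}"
  define p2 where "p2 = {(x, K) \<in> p. x \<notin> N}"
  have p12: "p = p1 \<union> p2" "p1 \<inter> p2 = {}" "finite p1" "finite p2"
    using pD(1) by (auto simp: p1_def p2_def intro: finite_subset[of _ p])
  have "u b - u a - (b - a) *\<^sub>R c = (\<Sum>(x, K)\<in>p. w K)"
  proof -
    have "(\<Sum>(x, K)\<in>p. (u (Sup K) - Sup K *\<^sub>R c) - (u (Inf K) - Inf K *\<^sub>R c))
        = (u b - b *\<^sub>R c) - (u a - a *\<^sub>R c)"
      by (rule additive_tagged_division_1[OF ab p])
    then show ?thesis by (simp add: w_def algebra_simps)
  qed
  also have "norm \<dots> \<le> (\<Sum>(x, K)\<in>p. norm (w K))"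
    using norm_sum[of "\<lambda>(x, K). w K" p] by (simp add: case_prod_unfold)
  also have "\<dots> = (\<Sum>(x, K)\<in>p1. norm (w K)) + (\<Sum>(x, K)\<in>p2. norm (w K))"
    using p12 by (simp add: sum.union_disjoint)
  also have "(\<Sum>(x, K)\<in>p2. norm (w K)) \<le> (M + \<eta>) * (b - a)"
  proof -
    have "(\<Sum>(x, K)\<in>p2. norm (w K)) \<le> (\<Sum>(x, K)\<in>p2. (M + \<eta>) * (Sup K - Inf K))"
    proof (rule sum_mono, clarify)
      fix x K assume "(x, K) \<in> p2"
      then have xK: "(x, K) \<in> p" "x \<notin> N" by (auto simp: p2_def)
      then obtain v z where K: "K = {v..z}" "v \<le> x" "x \<le> z" "a \<le> v" "z \<le> b"
        using box[OF xK(1)] by blast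
      have "K \<subseteq> ball x (d x)"
        using fine xK K(2-5) by (fastforce simp: fine_def \<gamma>_def)
      then have "norm (u z - u v - (z - v) *\<^sub>R c) \<le> (M + \<eta>) * (z - v)"
        using K xK(2) by (intro increment_between[where t = x] d) (auto simp: dist_real_def abs_minus_commute)
      then show "norm (w K) \<le> (M + \<eta>) * (Sup K - Inf K)"
        using K by (simp add: w_def)
    qed
    also have "\<dots> \<le> (\<Sum>(x, K)\<in>p. (M + \<eta>) * (Sup K - Inf K))"
    proof (rule sum_mono2)
      show "0 \<le> (case q of (x, K) \<Rightarrow> (M + \<eta>) * (Sup K - Inf K))" if "q \<in> p - p2" for q
        using that M \<eta>(1) len[of "fst q" "snd q"] by (auto simp: case_prod_unfold)
    qed (use p12 pD(1) in auto)
    also have "\<dots> = (M + \<eta>) * (b - a)"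
      using additive_tagged_division_1[OF ab p, of "\<lambda>x. x"]
      by (simp add: sum_distrib_left[symmetric] case_prod_unfold)
    finally show ?thesis .
  qed
  also have "(\<Sum>(x, K)\<in>p1. norm (w K)) \<le> 2 * \<eta>"
  proof -
    have p1: "p1 tagged_partial_division_of {a..b}"
      using p unfolding tagged_division_of_def
      by (auto intro: tagged_partial_division_subset simp: p1_def)
    define D where "D = snd ` p1"
    have D: "D division_of \<Union>D"
      unfolding D_def by (rule partial_division_of_tagged_division[OF p1])
    have sub: "\<Union>D \<subseteq> {a..b}" "\<Union>D \<subseteq> U"
      using fine pD(3) by (fastforce simp: D_def p1_def fine_def \<gamma>_def split: if_splits)+
    have short: "(\<Sum>I\<in>D. Sup I - Inf I) < \<delta>"
    proof -
      have "(\<Sum>I\<in>D. Sup I - Inf I) = measure lebesgue (\<Union>D)"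
        by (rule division_sum_length[OF D])
      also have "\<dots> \<le> measure lebesgue U"
        using sub(2) Um lmeasurable_division[OF D] by (intro measure_mono_fmeasurable) (auto simp: fmeasurableD)
      finally show ?thesis using U\<delta> by simp
    qed
    have nonneg: "0 \<le> Sup I - Inf I" if "I \<in> D" for I
      using that len by (auto simp: D_def p1_def)
    \<comment> \<open>Several tags may carry the same degenerate interval, so pairs can be replaced
      by intervals only if such intervals contribute 0. The \<open>if\<close> ensures this also for
      the empty interval, where \<open>Sup\<close> and \<open>Inf\<close> say nothing.\<close>
    have "(\<Sum>(x, K)\<in>p1. norm (w K)) = (\<Sum>I\<in>D. if interior I = {} then 0 else norm (w I))"
    proof -
      have "(\<Sum>(x, K)\<in>p1. norm (w K)) = (\<Sum>(x, K)\<in>p1. if interior K = {} then 0 else norm (w K))"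
      proof (rule sum.cong[OF refl], clarify)
        fix x K assume "(x, K) \<in> p1"
        then obtain v z where "K = {v..z}" "v \<le> z" using box[of x K] by (auto simp: p1_def)
        then show "norm (w K) = (if interior K = {} then 0 else norm (w K))"
          by (auto simp: w_def)
      qed
      also have "\<dots> = (\<Sum>I\<in>D. if interior I = {} then 0 else norm (w I))"
        unfolding D_def
      proof (rule sum.over_tagged_division_lemma[OF tagged_partial_division_of_Union_self[OF p1]])
        fix v z :: real assume "box v z = {}"
        then show "(if interior (cbox v z) = {} then 0 else norm (w (cbox v z))) = 0"
          by simp
      qed
      finally show ?thesis .
    qed
    also have "\<dots> \<le> (\<Sum>I\<in>D. norm (u (Sup I) - u (Inf I)) + (Sup I - Inf I) * norm c)"
    proof (rule sum_mono)
      fix I assume "I \<in> D"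
      then have "norm (w I) \<le> norm (u (Sup I) - u (Inf I)) + (Sup I - Inf I) * norm c"
        unfolding w_def using nonneg[of I] norm_triangle_ineq4[of "u (Sup I) - u (Inf I)" "(Sup I - Inf I) *\<^sub>R c"]
        by (simp del: cInf_le_cSup)
      moreover have "0 \<le> norm (w I)" by simp
      ultimately show "(if interior I = {} then 0 else norm (w I))
          \<le> norm (u (Sup I) - u (Inf I)) + (Sup I - Inf I) * norm c"
        by (smt (verit))
    qed
    also have "\<dots> = (\<Sum>I\<in>D. norm (u (Sup I) - u (Inf I))) + (\<Sum>I\<in>D. Sup I - Inf I) * norm c"
      by (simp add: sum.distrib sum_distrib_right)
    also have "\<dots> \<le> \<eta> + \<delta> * norm c"
      using \<delta>'[OF D sub(1)] short \<delta>(2) by (intro add_mono mult_right_mono) auto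
    finally show ?thesis using \<delta>(3) by simp
  qed
  finally show "norm (u b - u a - (b - a) *\<^sub>R c) \<le> M * (b - a) + e"
    using \<eta>(2) by (simp add: algebra_simps)
qed

text \<open>Near \<open>t\<close> the almost-everywhere derivative stays within \<open>e\<close> of
  \<open>H t\<close>; the mean value inequality with \<open>c = H t\<close> passes this on to every
  increment, hence to the derivative at \<open>t\<close> itself.\<close>

lemma abs_cont_on_has_vector_derivative:
  fixes u :: "real \<Rightarrow> 'a::real_normed_vector"
  assumes ac: "\<And>a b. {a..b} \<subseteq> {t0..} \<Longrightarrow> abs_cont_on {a..b} u"
    and ae: "AE t in lebesgue. t \<ge> t0 \<longrightarrow> (u has_vector_derivative H t) (at t within {t0..})"
    and cont: "continuous_on {t0..} H" and t: "t0 \<le> t"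
  shows "(u has_vector_derivative H t) (at t within {t0..})"
  unfolding has_vector_derivative_within_alt
proof (intro allI impI)
  fix e :: real assume "0 < e"
  obtain d where "d > 0" and d: "\<And>s. s \<ge> t0 \<Longrightarrow> \<bar>s - t\<bar> < d \<Longrightarrow> norm (H s - H t) < e"
    proof -
    have "t \<in> {t0..}" using t by simp
    then obtain d where "d > 0" "\<forall>s\<in>{t0..}. dist s t < d \<longrightarrow> dist (H s) (H t) < e"
      using cont \<open>0 < e\<close> unfolding continuous_on_iff by blast
    then show ?thesis by (intro that[of d]) (auto simp: dist_norm)
  qed
  have incr: "norm (u w - u v - (w - v) *\<^sub>R H t) \<le> e * (w - v)"
    if "t0 \<le> v" "v \<le> w" "\<bar>v - t\<bar> < d" "\<bar>w - t\<bar> < d" for v w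
  proof -
    have "{v..w} \<subseteq> {t0..}" using that(1) by auto
    then have "abs_cont_on {v..w} u" using ac[of v w] by simp
    moreover have "AE s in lebesgue. s \<in> {v..w} \<longrightarrow>
        (\<exists>A. (u has_vector_derivative A) (at s within {v..w}) \<and> norm (A - H t) \<le> e)"
    proof (rule eventually_mono[OF ae], intro impI)
      fix s assume s: "t0 \<le> s \<longrightarrow> (u has_vector_derivative H s) (at s within {t0..})" "s \<in> {v..w}"
      have "(u has_vector_derivative H s) (at s within {v..w})"
        using that(1) s by (auto intro!: has_vector_derivative_within_subset[where S = "{t0..}" and T = "{v..w}"])
      moreover have "norm (H s - H t) \<le> e"
        using s(2) that by (intro order.strict_implies_order[OF d]) auto
      ultimately show "\<exists>A. (u has_vector_derivative A) (at s within {v..w}) \<and> norm (A - H t) \<le> e"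
        by blast
    qed
    ultimately show ?thesis
      using that(2) \<open>0 < e\<close> by (intro abs_cont_on_norm_diff_le) simp_all
  qed
  have "norm (u s - u t - (s - t) *\<^sub>R H t) \<le> e * \<bar>s - t\<bar>" if s: "s \<in> {t0..}" "\<bar>s - t\<bar> < d" for s
  proof (cases "t \<le> s")
    case True
    then show ?thesis using incr[of t s] t s \<open>d > 0\<close> by simp
  next
    case False
    have "u s - u t - (s - t) *\<^sub>R H t = - (u t - u s - (t - s) *\<^sub>R H t)"
      by (simp add: algebra_simps)
    then have "norm (u s - u t - (s - t) *\<^sub>R H t) = norm (u t - u s - (t - s) *\<^sub>R H t)"
      by (metis norm_minus_cancel)
    then show ?thesis using incr[of s t] False t s \<open>d > 0\<close> by simp
  qed
  with \<open>d > 0\<close> show "\<exists>d>0. \<forall>s\<in>{t0..}. \<bar>s - t\<bar> < d \<longrightarrow>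
      norm (u s - u t - (s - t) *\<^sub>R H t) \<le> e * \<bar>s - t\<bar>" by blast
qed

section \<open>Riesz representation and the adjoint operator\<close>

lemma Riesz_representation:
  fixes l :: "'a::{real_inner,complete_space} \<Rightarrow> real"
  assumes l: "bounded_linear l"
  shows "\<exists>v. \<forall>x. l x = x \<bullet> v"
proof -
  interpret l: bounded_linear l by fact
  \<comment> \<open>The representing vector is the minimizer of \<open>J\<close>.\<close>
  define J where "J x = (norm x)\<^sup>2 - 2 * l x" for x
  obtain B where B: "\<And>x. norm (l x) \<le> norm x * B"
    using l.bounded by blast
  have lower: "- (B\<^sup>2) \<le> J x" for x
  proof -
    have "0 \<le> (norm x - B)\<^sup>2" by simp
    then show ?thesis using B[of x] by (simp add: J_def power2_diff)
  qed
  then have bdd: "bdd_below (range J)" by (auto intro!: bdd_belowI)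
  define m where "m = Inf (range J)"
  have m: "m \<le> J x" for x
    unfolding m_def using bdd by (simp add: cINF_lower)
  have "\<exists>x. J x < m + 1 / real (Suc n)" for n
    using cInf_lessD[of "range J" "m + 1 / real (Suc n)"] by (auto simp: m_def)
  then obtain X where X: "\<And>n. J (X n) < m + 1 / real (Suc n)" by metis
  \<comment> \<open>The parallelogram law; the linear part of \<open>J\<close> cancels, and bounding
    the midpoint from below by \<open>m\<close> makes every minimizing sequence Cauchy.\<close>
  have par: "(dist x y)\<^sup>2 \<le> 2 * (J x - m) + 2 * (J y - m)" for x y
  proof -
    have "(dist x y)\<^sup>2 = 2 * J x + 2 * J y - 4 * J ((1/2) *\<^sub>R (x + y))"
      by (simp add: J_def dist_norm power2_norm_eq_inner inner_add inner_diff
          l.add l.scaleR inner_commute algebra_simps)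
    then show ?thesis using m[of "(1/2) *\<^sub>R (x + y)"] by simp
  qed
  have "Cauchy X"
  proof (rule metric_CauchyI)
    fix e :: real assume "0 < e"
    obtain N where N: "4 / e\<^sup>2 < real N" using reals_Archimedean2 by blast
    have "dist (X i) (X j) < e" if ij: "i \<ge> N" "j \<ge> N" for i j
    proof -
      have small: "J (X k) - m < e\<^sup>2 / 4" if "k \<ge> N" for k
      proof -
        have "4 / e\<^sup>2 < real (Suc k)" using N that by simp
        then have "1 / real (Suc k) < e\<^sup>2 / 4"
          using \<open>0 < e\<close> by (simp add: field_simps del: of_nat_Suc)
        then show ?thesis using X[of k] by simp
      qed
      have "(dist (X i) (X j))\<^sup>2 < e\<^sup>2"
        using par[of "X i" "X j"] small[OF ij(1)] small[OF ij(2)] by simp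
      then show ?thesis using \<open>0 < e\<close> by (auto intro: power2_less_imp_less)
    qed
    then show "\<exists>M. \<forall>i\<ge>M. \<forall>j\<ge>M. dist (X i) (X j) < e" by blast
  qed
  then obtain v where v: "X \<longlonglongrightarrow> v"
    using Cauchy_convergent convergent_def by blast
  have "(\<lambda>n. J (X n)) \<longlonglongrightarrow> J v"
    unfolding J_def using v by (intro tendsto_intros l.tendsto)
  moreover have "(\<lambda>n. m + 1 / real (Suc n)) \<longlonglongrightarrow> m + 0"
    by (intro tendsto_add tendsto_const LIMSEQ_Suc[OF lim_1_over_n])
  ultimately have "J v \<le> m + 0"
    by (rule LIMSEQ_le) (use X less_imp_le in blast)
  then have Jv: "J v \<le> m" by simp
  have "l u = u \<bullet> v" for u
  proof (cases "u = 0")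
    case False
    define d where "d = u \<bullet> v - l u"
    \<comment> \<open>The minimizer of the quadratic \<open>J (v + s *\<^sub>R u)\<close> in
      \<open>s\<close>; the resulting decrease \<open>d\<^sup>2 / (u \<bullet> u)\<close> must
      vanish at a minimum.\<close>
    define s where "s = - d / (u \<bullet> u)"
    have "J (v + s *\<^sub>R u) = J v + s\<^sup>2 * (u \<bullet> u) + 2 * s * d"
      unfolding J_def d_def power2_norm_eq_inner
      by (simp add: inner_add l.add l.scaleR inner_commute[of v u] power2_eq_square algebra_simps)
    also have "\<dots> = J v - d\<^sup>2 / (u \<bullet> u)"
      using False by (simp add: s_def field_simps power2_eq_square)
    finally have "d\<^sup>2 / (u \<bullet> u) \<le> 0"
      using Jv m[of "v + s *\<^sub>R u"] by simp
    moreover have "0 < u \<bullet> u" using False by simp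
    ultimately have "d\<^sup>2 \<le> 0" by (simp only: divide_le_0_iff) auto
    then show ?thesis by (simp add: d_def)
  qed (simp add: l.zero)
  then show ?thesis by blast
qed

text \<open>\<open>adjoint\<close> is defined by choice, so its characteristic equation needs an
  existence proof: Riesz applied to \<open>K x \<bullet> y\<close> as a functional of
  \<open>x\<close>, for each \<open>y\<close>.\<close>

lemma adjoint_inner:
  fixes K :: "'h::{real_inner,complete_space} \<Rightarrow> 'k::real_inner"
  assumes K: "bounded_linear K"
  shows "K x \<bullet> y = x \<bullet> adjoint K y"
proof -
  have "\<exists>v. \<forall>x. K x \<bullet> y = x \<bullet> v" for y
    by (intro Riesz_representation bounded_linear_inner_left_comp K)
  then have "\<exists>K'. \<forall>x y. K x \<bullet> y = x \<bullet> K' y"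
    by metis
  then show ?thesis
    unfolding adjoint_def by (rule someI2_ex) blast
qed

text \<open>Boundedness gives the continuity of the coupling term, hence of the right-hand side of
  the equation.\<close>

lemma adjoint_bounded_linear:
  fixes K :: "'h::{real_inner,complete_space} \<Rightarrow> 'k::real_inner"
  assumes K: "bounded_linear K"
  shows "bounded_linear (adjoint K)"
proof -
  interpret K: bounded_linear K by fact
  obtain B where "0 \<le> B" and B: "\<And>x. norm (K x) \<le> norm x * B"
    using K.nonneg_bounded by blast
  show ?thesis
  proof (rule bounded_linear_intro)
    show "adjoint K (x + y) = adjoint K x + adjoint K y" for x y
      by (rule vector_eq_ldot[THEN iffD1]) (simp add: adjoint_inner[OF K, symmetric] inner_add_right)
    show "adjoint K (s *\<^sub>R x) = s *\<^sub>R adjoint K x" for s x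
      by (rule vector_eq_ldot[THEN iffD1]) (simp add: adjoint_inner[OF K, symmetric])
    show "norm (adjoint K y) \<le> norm y * B" for y
    proof (cases "adjoint K y = 0")
      case True
      then show ?thesis using \<open>0 \<le> B\<close> by simp
    next
      case False
      then have "norm (adjoint K y) * norm (adjoint K y) = K (adjoint K y) \<bullet> y"
        by (simp add: adjoint_inner[OF K] power2_norm_eq_inner[symmetric] power2_eq_square)
      also have "\<dots> \<le> norm (adjoint K y) * B * norm y"
        using norm_cauchy_schwarz B mult_right_mono order_trans norm_ge_zero by metis
      finally show ?thesis using False by (simp add: mult.commute mult.left_commute)
    qed
  qed
qed

section \<open>Gradients of convex functions\<close>

lemma GDERIV_gradient: "GDERIV F x :> D \<Longrightarrow> GDERIV F x :> gradient F x"
  by (simp add: gradient_eq)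

text \<open>Restriction to the line through \<open>x\<close> and \<open>y\<close> reduces this to
  the tangent inequality in one real variable.\<close>

lemma convex_on_above_gradient:
  fixes F :: "'a::real_inner \<Rightarrow> real"
  assumes conv: "convex_on UNIV F" and D: "GDERIV F x :> D"
  shows "F x + D \<bullet> (y - x) \<le> F y"
proof -
  define j where "j s = F (x + s *\<^sub>R (y - x))" for s :: real
  have "convex_on UNIV j"
  proof (rule convex_onI)
    fix t a b :: real assume t: "0 < t" "t < 1"
    have "x + ((1 - t) *\<^sub>R a + t *\<^sub>R b) *\<^sub>R (y - x)
        = (1 - t) *\<^sub>R (x + a *\<^sub>R (y - x)) + t *\<^sub>R (x + b *\<^sub>R (y - x))"
      by (simp add: algebra_simps)
    then show "j ((1 - t) *\<^sub>R a + t *\<^sub>R b) \<le> (1 - t) * j a + t * j b"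
      unfolding j_def using convex_onD[OF conv, of t] t by simp
  qed simp
  moreover have "(j has_field_derivative D \<bullet> (y - x)) (at 0)"
  proof -
    have F: "(F has_derivative (\<lambda>h. h \<bullet> D)) (at (x + 0 *\<^sub>R (y - x)))"
      using D by (simp add: gderiv_def)
    have "((\<lambda>s. x + s *\<^sub>R (y - x)) has_derivative (\<lambda>s. s *\<^sub>R (y - x))) (at 0)"
      by (auto intro!: derivative_eq_intros)
    from has_derivative_compose[OF this F] show ?thesis
      by (simp add: j_def[abs_def] has_field_derivative_def inner_commute mult_commute_abs)
  qed
  ultimately have "(D \<bullet> (y - x)) * (1 - 0) \<le> j 1 - j 0"
    by (intro convex_on_imp_above_tangent[of UNIV]) auto
  then show ?thesis by (simp add: j_def)
qed

lemma strongly_convex_above_gradient: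
  assumes conv: "strongly_convex m F" and D: "GDERIV F x :> D"
  shows "F x + D \<bullet> (y - x) + m / 2 * (norm (y - x))\<^sup>2 \<le> F y"
proof -
  have "GDERIV (\<lambda>x. F x - m / 2 * (norm x)\<^sup>2) x :> D - m *\<^sub>R x"
    using D unfolding gderiv_def power2_norm_eq_inner
    by (auto intro!: derivative_eq_intros simp: inner_diff_right inner_commute field_simps)
  from convex_on_above_gradient[OF conv[unfolded strongly_convex_def] this, of y]
  show ?thesis
    by (simp add: power2_norm_eq_inner inner_diff inner_commute algebra_simps)
qed

text \<open>The function \<open>F y - p \<bullet> y\<close> is minimal at \<open>x\<close>, so its
  derivative vanishes there. This turns the inclusions that define the equilibrium into
  equations.\<close>

lemma subdifferential_eq_gradient:
  assumes p: "p \<in> subdifferential (\<lambda>z. ereal (F z)) x" and D: "GDERIV F x :> D"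
  shows "p = D"
proof -
  have le: "F x + p \<bullet> (y - x) \<le> F y" for y
    using p by (auto simp: subdifferential_def simp flip: ereal_less_eq(3))
  have "((\<lambda>y. F y - p \<bullet> y) has_derivative (\<lambda>h. h \<bullet> D - p \<bullet> h)) (at x)"
    using D unfolding gderiv_def by (auto intro!: derivative_eq_intros)
  then have "(\<lambda>h. h \<bullet> D - p \<bullet> h) = (\<lambda>h. 0)"
    by (rule has_derivative_local_min) (use le in \<open>auto simp: inner_diff_right algebra_simps intro!: always_eventually\<close>)
  then have "(D - p) \<bullet> D - p \<bullet> (D - p) = 0" by meson
  then have "(D - p) \<bullet> (D - p) = 0" by (simp add: inner_diff inner_commute)
  then show ?thesis by simp
qed

section \<open>Expectations of gradients and the Wasserstein distance\<close>

text \<open>Expectations of vectors are known only through their inner products, so the norm is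
  reached by testing in the direction \<open>v - w\<close> itself.\<close>

lemma has_expectation_norm_diff_le:
  assumes m: "prob_space m" and G: "has_expectation m G v" and H: "has_expectation m H w"
    and le: "\<And>s. norm (G s - H s) \<le> c"
  shows "norm (v - w) \<le> c"
proof (cases "v = w")
  case True
  then show ?thesis using order_trans[OF norm_ge_zero le] by simp
next
  case False
  interpret prob_space m by fact
  define u where "u = v - w"
  have int: "integrable m (\<lambda>s. G s \<bullet> u)" "integrable m (\<lambda>s. H s \<bullet> u)"
    using G H by (auto simp: has_expectation_def)
  have "norm u * norm u = v \<bullet> u - w \<bullet> u"
    by (simp add: u_def power2_norm_eq_inner[symmetric] power2_eq_square[symmetric] inner_diff_left[symmetric])
  also have "\<dots> = (\<integral>s. G s \<bullet> u - H s \<bullet> u \<partial>m)"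
    using G H int by (simp add: has_expectation_def)
  also have "\<dots> \<le> (\<integral>s. c * norm u \<partial>m)"
  proof (rule integral_mono)
    show "G s \<bullet> u - H s \<bullet> u \<le> c * norm u" for s
      using norm_cauchy_schwarz[of "G s - H s" u] mult_right_mono[OF le[of s] norm_ge_zero[of u]]
      by (simp add: inner_diff_left)
  qed (use int in auto)
  also have "\<dots> = c * norm u" by (simp add: prob_space)
  finally show ?thesis using False by (simp add: u_def)
qed

text \<open>A multiple of the component of \<open>G\<close> along \<open>v - w\<close> is an
  admissible test function: \<open>has_expectation\<close> supplies exactly the integrability that
  \<open>W1\<close> asks for.\<close>

lemma has_expectation_W1_le:
  assumes G: "has_expectation m G v" "has_expectation m' G w"
    and lip: "b-lipschitz_on UNIV G" and b: "0 < b" and W: "W1 m m' \<le> ereal c"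
  shows "norm (v - w) \<le> b * c"
proof (cases "v = w")
  case True
  \<comment> \<open>When \<open>v = w\<close> only \<open>0 \<le> c\<close> is left to show; the
    zero test function gives it.\<close>
  have "(\<lambda>_. 0) \<in> {k. 1-lipschitz_on UNIV k \<and> integrable m k \<and> integrable m' k}"
    by (auto intro!: lipschitz_onI)
  from SUP_upper[OF this, of "\<lambda>k. ereal \<bar>(\<integral>s. k s \<partial>m) - (\<integral>s. k s \<partial>m')\<bar>"]
  have "ereal 0 \<le> W1 m m'" by (simp add: W1_def zero_ereal_def)
  from order_trans[OF this W] have "0 \<le> c" by simp
  then show ?thesis using True b by simp
next
  case False
  define u where "u = v - w"
  have u: "0 < norm u" using False by (simp add: u_def)
  \<comment> \<open>The component along \<open>u\<close> has Lipschitz constant at most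
    \<open>b * norm u\<close>, which this factor normalizes to 1.\<close>
  define a where "a = 1 / (b * norm u)"
  have a: "0 < a" using b u by (simp add: a_def)
  define k where "k s = a * (G s \<bullet> u)" for s
  have "1-lipschitz_on UNIV k"
  proof (rule lipschitz_onI)
    fix s t
    have "dist (k s) (k t) = a * \<bar>(G s - G t) \<bullet> u\<bar>"
      using a by (simp add: k_def dist_real_def abs_mult right_diff_distrib[symmetric] inner_diff_left)
    also have "\<dots> \<le> a * (norm (G s - G t) * norm u)"
      using a by (intro mult_left_mono Cauchy_Schwarz_ineq2) auto
    also have "\<dots> \<le> a * (b * dist s t * norm u)"
      using a lipschitz_onD[OF lip, of s t] by (intro mult_left_mono mult_right_mono) (auto simp: dist_norm)
    also have "\<dots> = 1 * dist s t" using b u by (simp add: a_def)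
    finally show "dist (k s) (k t) \<le> 1 * dist s t" .
  qed simp
  moreover have "integrable m k" "integrable m' k"
    using G by (auto simp: has_expectation_def k_def[abs_def])
  ultimately have "ereal \<bar>(\<integral>s. k s \<partial>m) - (\<integral>s. k s \<partial>m')\<bar> \<le> W1 m m'"
    unfolding W1_def by (intro SUP_upper) auto
  also have "\<dots> \<le> ereal c" by fact
  also have "(\<integral>s. k s \<partial>m) - (\<integral>s. k s \<partial>m') = a * (u \<bullet> u)"
    using G by (simp add: has_expectation_def k_def u_def inner_diff_left right_diff_distrib)
  also have "\<dots> = norm u / b"
    using b u by (simp add: a_def power2_norm_eq_inner[symmetric] power2_eq_square)
  finally show ?thesis using b by (simp add: u_def field_simps)
qed

lemma (in prob_space) distr_pair_snd:
  assumes "sigma_finite_measure N"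
  shows "distr (M \<Otimes>\<^sub>M N) N snd = N"
proof (intro measure_eqI)
  interpret N: sigma_finite_measure N by fact
  fix A assume A: "A \<in> sets (distr (M \<Otimes>\<^sub>M N) N snd)"
  then have "emeasure (distr (M \<Otimes>\<^sub>M N) N snd) A = emeasure (M \<Otimes>\<^sub>M N) (space M \<times> A)"
    by (auto simp add: emeasure_distr space_pair_measure dest: sets.sets_into_space intro!: arg_cong2[where f=emeasure])
  with A show "emeasure (distr (M \<Otimes>\<^sub>M N) N snd) A = emeasure N A"
    by (simp add: N.emeasure_pair_measure_Times emeasure_space_1)
qed simp

text \<open>Composition with \<open>T\<close> sends every test function for the image measures to a
  test function for \<open>p\<close> and \<open>q\<close> with the same expectations, so a
  1-Lipschitz push-forward cannot increase the distance.\<close>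

lemma W1_le_W1_image:
  fixes T :: "'a::metric_space \<Rightarrow> 'b::metric_space"
  assumes T: "1-lipschitz_on UNIV T" "T \<in> measurable p m" "T \<in> measurable q n"
    and d: "distr p m T = m" "distr q n T = n"
  shows "W1 m n \<le> W1 p q"
  unfolding W1_def
proof (rule SUP_least)
  fix k :: "'b \<Rightarrow> real"
  assume "k \<in> {k. 1-lipschitz_on UNIV k \<and> integrable m k \<and> integrable n k}"
  then have k: "1-lipschitz_on UNIV k" "integrable m k" "integrable n k" by auto
  have "(\<integral>s. k s \<partial>m) = (\<integral>z. k (T z) \<partial>p)" "(\<integral>s. k s \<partial>n) = (\<integral>z. k (T z) \<partial>q)"
    using integral_distr[OF T(2), of k] integral_distr[OF T(3), of k] k d by (auto simp: borel_measurable_integrable)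
  moreover have "integrable p (\<lambda>z. k (T z))" "integrable q (\<lambda>z. k (T z))"
    using k d T by (auto intro: integrable_distr)
  moreover have "1-lipschitz_on UNIV (\<lambda>z. k (T z))"
    using lipschitz_on_compose2[OF T(1), of 1 k] lipschitz_on_subset[OF k(1)] by auto
  ultimately have T_mem: "(\<lambda>z. k (T z)) \<in> {k. 1-lipschitz_on UNIV k \<and> integrable p k \<and> integrable q k}"
    and eq: "(\<integral>s. k s \<partial>m) = (\<integral>z. k (T z) \<partial>p)" "(\<integral>s. k s \<partial>n) = (\<integral>z. k (T z) \<partial>q)"
    by auto
  show "ereal \<bar>(\<integral>s. k s \<partial>m) - (\<integral>s. k s \<partial>n)\<bar>
      \<le> (SUP k\<in>{k. 1-lipschitz_on UNIV k \<and> integrable p k \<and> integrable q k}.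
          ereal \<bar>(\<integral>s. k s \<partial>p) - (\<integral>s. k s \<partial>q)\<bar>)"
    unfolding eq by (rule SUP_upper[OF T_mem])
qed

text \<open>The sensitivity assumption concerns product measures only; keeping the other factor
  fixed and projecting extracts a bound for a single family.\<close>

lemma W1_le_W1_pair_fst:
  fixes m m' :: "'a::metric_space measure" and n :: "'b::metric_space measure"
  assumes "prob_space n"
  shows "W1 m m' \<le> W1 (m \<Otimes>\<^sub>M n) (m' \<Otimes>\<^sub>M n)"
proof (rule W1_le_W1_image[where T = fst])
  show "1-lipschitz_on UNIV (fst :: 'a \<times> 'b \<Rightarrow> 'a)"
    by (rule lipschitz_onI) (auto simp: dist_fst_le)
qed (auto intro: prob_space.distr_pair_fst assms)

lemma W1_le_W1_pair_snd:
  fixes m :: "'a::metric_space measure" and n n' :: "'b::metric_space measure"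
  assumes "prob_space m" "prob_space n" "prob_space n'"
  shows "W1 n n' \<le> W1 (m \<Otimes>\<^sub>M n) (m \<Otimes>\<^sub>M n')"
proof (rule W1_le_W1_image[where T = snd])
  show "1-lipschitz_on UNIV (snd :: 'a \<times> 'b \<Rightarrow> 'b)"
    by (rule lipschitz_onI) (auto simp: dist_snd_le)
qed (auto intro!: prob_space.distr_pair_snd assms prob_space_imp_sigma_finite)

lemma expected_GDERIV:
  assumes "expectations_well_defined F M"
  shows "GDERIV (expected F (M x')) x :> gradient (expected F (M x')) x"
    and "has_expectation (M x') (grad1 F x) (gradient (expected F (M x')) x)"
proof -
  obtain v where v: "GDERIV (expected F (M x')) x :> v" "has_expectation (M x') (grad1 F x) v"
    using assms[unfolded expectations_well_defined_def, THEN spec, THEN spec, of x' x] by auto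
  with gradient_eq[OF v(1)]
  show "GDERIV (expected F (M x')) x :> gradient (expected F (M x')) x"
    and "has_expectation (M x') (grad1 F x) (gradient (expected F (M x')) x)"
    by simp_all
qed

lemma expected_gradient_lipschitz:
  assumes "expectations_well_defined F M" "prob_space (M x')"
    and "\<And>\<xi>. c-lipschitz_on UNIV (\<lambda>x. grad1 F x \<xi>)"
  shows "c-lipschitz_on UNIV (gradient (expected F (M x')))"
proof (rule lipschitz_onI)
  fix x y
  show "dist (gradient (expected F (M x')) x) (gradient (expected F (M x')) y) \<le> c * dist x y"
    unfolding dist_norm
  proof (rule has_expectation_norm_diff_le[OF assms(2) expected_GDERIV(2)[OF assms(1), of x' x]
        expected_GDERIV(2)[OF assms(1), of x' y]])
    show "norm (grad1 F x s - grad1 F y s) \<le> c * norm (x - y)" for s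
      using lipschitz_onD[OF assms(3), of x y s] by (simp add: dist_norm)
  qed
qed (rule lipschitz_on_nonneg[OF assms(3)])

section \<open>Decay of the energy with distributions frozen at the equilibrium\<close>

text \<open>Gronwall's inequality: the integrating factor makes \<open>W\<close>
  nonincreasing.\<close>

lemma exp_decay:
  fixes V V' :: "real \<Rightarrow> real"
  assumes V: "\<And>t. t \<ge> t0 \<Longrightarrow> (V has_real_derivative V' t) (at t within {t0..})"
    and le: "\<And>t. t \<ge> t0 \<Longrightarrow> V' t \<le> - c * V t" and t: "t0 \<le> t"
  shows "V t \<le> V t0 * exp (- c * (t - t0))"
proof -
  define W where "W s = V s * exp (c * (s - t0))" for s
  have W: "(W has_real_derivative (V' s + c * V s) * exp (c * (s - t0))) (at s within {t0..})" if "s \<ge> t0" for s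
    unfolding W_def using V[OF that] by (auto intro!: derivative_eq_intros simp: algebra_simps)
  \<comment> \<open>At \<open>t0\<close> only a one-sided derivative is available, hence
    monotonicity from derivatives in the open interval and continuity up to the ends.\<close>
  have "W t \<le> W t0"
  proof (rule DERIV_nonpos_imp_decreasing_open[where f = W])
    show "t0 \<le> t" by (rule t)
    show "continuous_on {t0..t} W"
      using W by (intro continuous_on_subset[OF DERIV_continuous_on[of "{t0..}"]]) auto
    show "\<exists>y. DERIV W s :> y \<and> y \<le> 0" if "t0 < s" "s < t" for s
    proof (intro exI conjI)
      show "DERIV W s :> (V' s + c * V s) * exp (c * (s - t0))"
        using W[of s] that by (simp add: at_within_interior[of s "{t0..}"] interior_real_atLeast)
      show "(V' s + c * V s) * exp (c * (s - t0)) \<le> 0"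
        using le[of s] that by (intro mult_nonpos_nonneg) auto
    qed
  qed
  then have "W t * exp (- c * (t - t0)) \<le> W t0 * exp (- c * (t - t0))"
    by (rule mult_right_mono) simp
  then show ?thesis by (simp add: W_def mult.assoc exp_add[symmetric])
qed

text \<open>The pointwise algebra, with \<open>w\<close> the displacement, \<open>z\<close> the
  velocity, \<open>G\<close> the Lagrangian difference, \<Gamma> its gradient and \<open>E\<close>
  the gap. The terms \<open>\<Gamma> \<bullet> z\<close> cancel, leaving
  \<open>- sqrt \<mu> * (\<Gamma> \<bullet> w)\<close>; the surplus
  \<open>\<mu> / 2 * (norm w)\<^sup>2\<close> in \<open>up\<close> compensates the negative square
  in \<open>v \<bullet> z\<close>. This alone yields the rate \<open>sqrt \<mu>\<close>, of which
  the gap consumes at most three quarters.\<close>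

lemma energy_derivative_le:
  fixes w z v E \<Gamma> :: "'a::real_inner"
  assumes \<mu>: "0 < \<mu>" and v: "v = sqrt \<mu> *\<^sub>R w + z"
    and up: "G + \<mu> / 2 * (norm w)\<^sup>2 \<le> \<Gamma> \<bullet> w" and low: "\<mu> / 2 * (norm w)\<^sup>2 \<le> G"
    and E: "norm E \<le> \<rho> * \<mu> * norm w" and \<rho>: "0 \<le> \<rho>" "\<rho> \<le> 3 / 4"
  shows "\<Gamma> \<bullet> z + v \<bullet> (- sqrt \<mu> *\<^sub>R z - \<Gamma> - E) \<le> - (sqrt \<mu> / 4) * (G + 1 / 2 * (norm v)\<^sup>2)"
proof -
  define s where "s = sqrt \<mu>"
  have s: "0 < s" "\<mu> = s * s" using \<mu> by (auto simp: s_def)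
  \<comment> \<open>Polarization: expand the square of \<open>s *\<^sub>R w = v - z\<close>.\<close>
  have vz: "v \<bullet> z = (norm v)\<^sup>2 / 2 + (norm z)\<^sup>2 / 2 - \<mu> / 2 * (norm w)\<^sup>2"
  proof -
    have "v = s *\<^sub>R w + z" by (simp add: v s_def)
    then show ?thesis unfolding power2_norm_eq_inner s(2)
      by (simp add: inner_add inner_commute field_simps)
  qed
  have "- (v \<bullet> E) \<le> norm v * norm E"
    using Cauchy_Schwarz_ineq2[of v E] by simp
  also have "\<dots> \<le> norm v * (\<rho> * \<mu> * norm w)"
    using E by (rule mult_left_mono) simp
  also have "\<dots> = \<rho> * s * (norm v * (s * norm w))"
    by (simp add: s(2))
  \<comment> \<open>Young's inequality, weighted so that both squares are parts of the energy: the
    first is at most \<open>G\<close> by \<open>low\<close>, the second is the kinetic term.\<close>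
  also have "\<dots> \<le> \<rho> * s * (\<mu> / 2 * (norm w)\<^sup>2 + 1 / 2 * (norm v)\<^sup>2)"
  proof (rule mult_left_mono)
    show "norm v * (s * norm w) \<le> \<mu> / 2 * (norm w)\<^sup>2 + 1 / 2 * (norm v)\<^sup>2"
      using sum_squares_ge_zero[of "norm v - s * norm w" 0]
      by (simp add: s(2) power2_eq_square algebra_simps)
  qed (use s \<rho> in simp)
  also have "\<dots> \<le> 3 / 4 * s * (G + 1 / 2 * (norm v)\<^sup>2)"
    using low s \<rho> by (intro mult_mono) (auto intro!: add_nonneg_nonneg mult_nonneg_nonneg)
  finally have vE: "- (v \<bullet> E) \<le> 3 / 4 * s * (G + 1 / 2 * (norm v)\<^sup>2)" .
  have "\<Gamma> \<bullet> z + v \<bullet> (- s *\<^sub>R z - \<Gamma> - E) = - s * (\<Gamma> \<bullet> w) - s * (v \<bullet> z) - v \<bullet> E"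
    by (simp add: v s_def[symmetric] inner_add inner_diff inner_commute algebra_simps)
  moreover have "s * (G + \<mu> / 2 * (norm w)\<^sup>2) \<le> s * (\<Gamma> \<bullet> w)"
    using up s by (intro mult_left_mono) auto
  moreover have "0 \<le> s * (norm z)\<^sup>2" using s by simp
  ultimately show ?thesis using vE unfolding vz s_def[symmetric]
    by (simp add: algebra_simps)
qed

text \<open>Separates the dynamics from the measures: \<Phi> and \<Psi> are the averaged objectives
  at the equilibrium distributions, and the gap enters only as a continuous perturbation
  \<open>E\<close> bounded linearly in the displacement.\<close>

lemma saddle_flow_decay:
  fixes K :: "'h::{real_inner,complete_space} \<Rightarrow> 'k::{real_inner,complete_space}"
    and \<Phi> :: "'h \<Rightarrow> real" and \<Psi> :: "'k \<Rightarrow> real"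
    and E :: "'h \<times> 'k \<Rightarrow> 'h \<times> 'k" and Z :: "real \<Rightarrow> 'h \<times> 'k"
  assumes K: "bounded_linear K" and \<mu>: "0 < \<mu>" and \<rho>: "0 \<le> \<rho>" "\<rho> \<le> 3 / 4"
    and \<Phi>: "\<And>x. GDERIV \<Phi> x :> \<Phi>' x" "continuous_on UNIV \<Phi>'"
      "\<And>x y. \<Phi> x + \<Phi>' x \<bullet> (y - x) + \<mu> / 2 * (norm (y - x))\<^sup>2 \<le> \<Phi> y"
    and \<Psi>: "\<And>x. GDERIV \<Psi> x :> \<Psi>' x" "continuous_on UNIV \<Psi>'"
      "\<And>x y. \<Psi> x + \<Psi>' x \<bullet> (y - x) + \<mu> / 2 * (norm (y - x))\<^sup>2 \<le> \<Psi> y"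
    and saddle: "\<Phi>' xbar + adjoint K ybar = 0" "\<Psi>' ybar - K xbar = 0"
    and E: "continuous_on UNIV E" "\<And>z. norm (E z) \<le> \<rho> * \<mu> * norm (z - (xbar, ybar))"
    and L: "\<And>x y. L x y = \<Phi> x + y \<bullet> K x - \<Psi> y"
    and sol: "is_solution \<mu> L E t0 Z" and t: "t0 \<le> t"
  shows "\<mu> / 2 * (norm (Z t - (xbar, ybar)))\<^sup>2 \<le> L (fst (Z t)) ybar - L xbar (snd (Z t))"
    and "L (fst (Z t)) ybar - L xbar (snd (Z t))
      \<le> energy \<mu> L (xbar, ybar) t0 Z t0 * exp (- (sqrt \<mu> / 4) * (t - t0))"
proof -
  interpret K: bounded_linear K by fact
  interpret A: bounded_linear "adjoint K" by (rule adjoint_bounded_linear[OF K])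
  note adj = adjoint_inner[OF K]
  define s where "s = sqrt \<mu>"
  have s: "0 < s" "s * s = \<mu>" using \<mu> by (auto simp: s_def)
  define G where "G z = L (fst z) ybar - L xbar (snd z)" for z
  define \<Gamma> where "\<Gamma> z = (\<Phi>' (fst z) + adjoint K ybar, \<Psi>' (snd z) - K xbar)" for z
  have saddle': "\<Phi>' xbar = - adjoint K ybar" "\<Psi>' ybar = K xbar"
    using saddle by (auto simp: eq_neg_iff_add_eq_0)
  have normsq: "(norm z)\<^sup>2 = (norm (fst z))\<^sup>2 + (norm (snd z))\<^sup>2" for z :: "'h \<times> 'k"
    by (simp add: power2_norm_eq_inner inner_prod_def)
  have adj': "adjoint K y \<bullet> x = y \<bullet> K x" "x \<bullet> adjoint K y = y \<bullet> K x" for x y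
    using adj[of x y] by (simp_all add: inner_commute)
  \<comment> \<open>Strong convexity expanded at the equilibrium; the saddle equations make its
    first-order terms cancel the coupling.\<close>
  have low: "\<mu> / 2 * (norm (z - (xbar, ybar)))\<^sup>2 \<le> G z" for z
  proof -
    have "\<Phi>' xbar \<bullet> (fst z - xbar) = ybar \<bullet> K xbar - ybar \<bullet> K (fst z)"
      by (simp add: saddle' inner_diff_right adj')
    moreover have "\<Psi>' ybar \<bullet> (snd z - ybar) = snd z \<bullet> K xbar - ybar \<bullet> K xbar"
      by (simp add: saddle' inner_diff_right inner_commute)
    moreover have "\<mu> / 2 * (norm (z - (xbar, ybar)))\<^sup>2
        = \<mu> / 2 * (norm (fst z - xbar))\<^sup>2 + \<mu> / 2 * (norm (snd z - ybar))\<^sup>2"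
      by (simp add: normsq distrib_left)
    ultimately show ?thesis
      using \<Phi>(3)[of xbar "fst z"] \<Psi>(3)[of ybar "snd z"] unfolding G_def L by linarith
  qed
  \<comment> \<open>The same inequality expanded at the current point and evaluated at the
    equilibrium.\<close>
  have up: "G z + \<mu> / 2 * (norm (z - (xbar, ybar)))\<^sup>2 \<le> \<Gamma> z \<bullet> (z - (xbar, ybar))" for z
  proof -
    have "\<Gamma> z \<bullet> (z - (xbar, ybar)) = - (\<Phi>' (fst z) \<bullet> (xbar - fst z)) + (ybar \<bullet> K (fst z) - ybar \<bullet> K xbar)
        - \<Psi>' (snd z) \<bullet> (ybar - snd z) - (snd z \<bullet> K xbar - ybar \<bullet> K xbar)"
      by (simp add: \<Gamma>_def inner_prod_def inner_add_left inner_diff adj' inner_commute[of "K xbar"])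
    moreover have "\<mu> / 2 * (norm (z - (xbar, ybar)))\<^sup>2
        = \<mu> / 2 * (norm (xbar - fst z))\<^sup>2 + \<mu> / 2 * (norm (ybar - snd z))\<^sup>2"
      by (simp add: normsq distrib_left norm_minus_commute)
    ultimately show ?thesis
      using \<Phi>(3)[of "fst z" xbar] \<Psi>(3)[of "snd z" ybar] unfolding G_def L by linarith
  qed
  define u where "u = velocity t0 Z"
  have Z: "(Z has_vector_derivative u t) (at t within {t0..})" if "t0 \<le> t" for t
    using sol that unfolding is_solution_def u_def velocity_def vector_derivative_works[symmetric] by blast
  have Zc: "continuous_on {t0..} Z"
    using Z by (auto simp: continuous_on_eq_continuous_within intro!: has_vector_derivative_continuous)
  have uc: "continuous_on {t0..} u"
    using sol by (simp add: is_solution_def u_def)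
  \<comment> \<open>\<open>D\<close> is the gradient field at the extrapolated points;
    \<open>H\<close> is the equation solved for the acceleration. \<open>H\<close> is defined for
    all times and continuous, so it can serve as the derivative of \<open>u\<close>
    everywhere.\<close>
  define D where "D t = (\<Phi>' (fst (Z t)) + adjoint K (snd (Z t) + (1 / s) *\<^sub>R snd (u t)),
      \<Psi>' (snd (Z t)) - K (fst (Z t) + (1 / s) *\<^sub>R fst (u t)))" for t
  define H where "H t = - (2 * s) *\<^sub>R u t - D t - E (Z t)" for t
  have gradL: "gradient (\<lambda>x. L x y) x = \<Phi>' x + adjoint K y"
      "gradient (\<lambda>y. L x y) y = K x - \<Psi>' y" for x y
  proof -
    show "gradient (\<lambda>x. L x y) x = \<Phi>' x + adjoint K y"
      using \<Phi>(1)[of x] unfolding L gderiv_def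
      by (intro gradient_eq) (auto simp: gderiv_def inner_add_right adj[symmetric] inner_commute
          intro!: derivative_eq_intros K.has_derivative)
    show "gradient (\<lambda>y. L x y) y = K x - \<Psi>' y"
      using \<Psi>(1)[of y] unfolding L gderiv_def
      by (intro gradient_eq) (auto simp: gderiv_def inner_diff_right
          intro!: derivative_eq_intros)
  qed
  have u: "(u has_vector_derivative H t) (at t within {t0..})" if "t0 \<le> t" for t
  proof (rule abs_cont_on_has_vector_derivative[OF _ _ _ that])
    show "abs_cont_on {a..b} u" if "{a..b} \<subseteq> {t0..}" for a b
      using sol that unfolding is_solution_def u_def by blast
    have eqn: "AE t in lebesgue. t \<ge> t0 \<longrightarrow> (\<exists>A. (u has_vector_derivative A) (at t within {t0..}) \<and>
        A + (2 * s) *\<^sub>R u t + D t + E (Z t) = 0)"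
      using sol unfolding is_solution_def u_def[symmetric] s_def[symmetric] Let_def gradL D_def
      by (simp add: minus_diff_eq)
    show "AE t in lebesgue. t \<ge> t0 \<longrightarrow> (u has_vector_derivative H t) (at t within {t0..})"
    proof (rule eventually_mono[OF eqn], clarify)
      fix t A assume "(u has_vector_derivative A) (at t within {t0..})"
        and "A + (2 * s) *\<^sub>R u t + D t + E (Z t) = 0"
      moreover from this(2) have "A - H t = 0"
        by (simp add: H_def algebra_simps)
      ultimately show "(u has_vector_derivative H t) (at t within {t0..})" by simp
    qed
    show "continuous_on {t0..} H"
      unfolding H_def D_def
      by (intro continuous_intros uc continuous_on_compose2[OF E(1) Zc] continuous_on_compose2[OF \<Phi>(2)]
          continuous_on_compose2[OF \<Psi>(2)] K.continuous_on A.continuous_on continuous_on_fst[OF Zc]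
          continuous_on_snd[OF Zc] continuous_on_fst[OF uc] continuous_on_snd[OF uc]) auto
  qed

  define v where "v t = s *\<^sub>R (Z t - (xbar, ybar)) + u t" for t
  define V where "V t = G (Z t) + 1 / 2 * (norm (v t))\<^sup>2" for t
  have V_energy: "V t = energy \<mu> L (xbar, ybar) t0 Z t" for t
    by (simp add: V_def G_def v_def energy_def u_def s_def)
  have dV: "(V has_real_derivative \<Gamma> (Z t) \<bullet> u t + v t \<bullet> (s *\<^sub>R u t + H t)) (at t within {t0..})"
    if "t0 \<le> t" for t
  proof -
    have G': "(G has_derivative (\<lambda>h. h \<bullet> \<Gamma> z)) (at z)" for z
    proof -
      have "((\<lambda>z. \<Phi> (fst z)) has_derivative (\<lambda>h. fst h \<bullet> \<Phi>' (fst z))) (at z)"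
        by (rule has_derivative_compose[OF has_derivative_fst[OF has_derivative_ident] \<Phi>(1)[unfolded gderiv_def]])
      moreover have "((\<lambda>z. \<Psi> (snd z)) has_derivative (\<lambda>h. snd h \<bullet> \<Psi>' (snd z))) (at z)"
        by (rule has_derivative_compose[OF has_derivative_snd[OF has_derivative_ident] \<Psi>(1)[unfolded gderiv_def]])
      ultimately show ?thesis
        unfolding G_def L
        by (auto intro!: derivative_eq_intros K.has_derivative simp: \<Gamma>_def inner_prod_def inner_add_right inner_diff_right adj' inner_commute[of _ "K _"])
    qed
    have "((\<lambda>t. G (Z t)) has_derivative (\<lambda>h. (h *\<^sub>R u t) \<bullet> \<Gamma> (Z t))) (at t within {t0..})"
      using Z[OF that] by (intro has_derivative_compose[OF _ G']) (simp add: has_vector_derivative_def)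
    moreover have "(v has_derivative (\<lambda>h. h *\<^sub>R (s *\<^sub>R u t + H t))) (at t within {t0..})"
      using Z[OF that] u[OF that] unfolding v_def has_vector_derivative_def
      by (auto intro!: derivative_eq_intros simp: algebra_simps)
    ultimately show ?thesis
      unfolding V_def power2_norm_eq_inner has_field_derivative_def
      by (auto intro!: derivative_eq_intros simp: inner_commute algebra_simps)
  qed
  have le: "\<Gamma> (Z t) \<bullet> u t + v t \<bullet> (s *\<^sub>R u t + H t) \<le> - (s / 4) * V t" for t
  proof -
    \<comment> \<open>By definition of \<open>v\<close>, \<open>snd (Z t) + (1 / s) *\<^sub>R snd (u
      t) = ybar + (1 / s) *\<^sub>R snd (v t)\<close>, and likewise for \<open>fst\<close>.\<close>
    have D: "D t = \<Gamma> (Z t) + (1 / s) *\<^sub>R (adjoint K (snd (v t)), - K (fst (v t)))"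
      using s by (simp add: D_def \<Gamma>_def v_def A.add A.diff A.scaleR K.add K.diff K.scaleR algebra_simps)
    have skew: "v t \<bullet> (adjoint K (snd (v t)), - K (fst (v t))) = 0"
      by (simp add: inner_prod_def adj[symmetric] inner_commute)
    have "v t \<bullet> (s *\<^sub>R u t + H t) = v t \<bullet> (- s *\<^sub>R u t - \<Gamma> (Z t) - E (Z t))"
      unfolding H_def D by (simp add: inner_add_right inner_diff_right skew algebra_simps del: scaleR_Pair)
    then show ?thesis
      using energy_derivative_le[OF \<mu> _ up low E(2) \<rho>, of "v t" "Z t" "u t"]
      by (simp add: v_def V_def s_def)
  qed
  show "\<mu> / 2 * (norm (Z t - (xbar, ybar)))\<^sup>2 \<le> L (fst (Z t)) ybar - L xbar (snd (Z t))"
    using low[of "Z t"] by (simp add: G_def)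
  have "G (Z t) \<le> V t" by (simp add: V_def)
  also have "V t \<le> V t0 * exp (- (s / 4) * (t - t0))"
    by (rule exp_decay[OF dV le t])
  finally show "L (fst (Z t)) ybar - L xbar (snd (Z t))
      \<le> energy \<mu> L (xbar, ybar) t0 Z t0 * exp (- (sqrt \<mu> / 4) * (t - t0))"
    by (simp add: G_def V_energy s_def)
qed

section \<open>Gradients under decision-dependent distributions, and the convergence theorem\<close>

lemma gradient_expected_gap:
  assumes wd: "expectations_well_defined F M" and lip: "b-lipschitz_on UNIV (\<lambda>\<xi>. grad1 F x \<xi>)"
    and b: "0 < b" and W: "W1 (M x1) (M x2) \<le> ereal c"
  shows "norm (gradient (expected F (M x1)) x - gradient (expected F (M x2)) x) \<le> b * c"
  by (rule has_expectation_W1_le[OF expected_GDERIV(2)[OF wd, of x1 x] expected_GDERIV(2)[OF wd, of x2 x] lip b W])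

text \<open>The decision enters both as the point and through the distribution. Changing the
  distribution first costs \<open>b * \<tau>\<close> through \<open>W1\<close>; moving the point
  under a fixed distribution then costs \<open>c\<close>. Continuity of the gap along the trajectory
  rests on this.\<close>

lemma continuous_gradient_expected_diagonal:
  fixes F :: "'a::real_inner \<Rightarrow> 's::metric_space \<Rightarrow> real"
  assumes wd: "expectations_well_defined F M" and prob: "\<And>x. prob_space (M x)"
    and lip: "\<And>x. b-lipschitz_on UNIV (\<lambda>\<xi>. grad1 F x \<xi>)" "\<And>\<xi>. c-lipschitz_on UNIV (\<lambda>x. grad1 F x \<xi>)"
    and b: "0 < b" and W: "\<And>x y. W1 (M x) (M y) \<le> ereal (\<tau> * norm (x - y))" and \<tau>: "0 \<le> \<tau>"
  shows "continuous_on UNIV (\<lambda>x. gradient (expected F (M x)) x)"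
proof (rule lipschitz_on_continuous_on)
  show "(b * \<tau> + c)-lipschitz_on UNIV (\<lambda>x. gradient (expected F (M x)) x)"
  proof (rule lipschitz_onI)
    fix x y
    have "dist (gradient (expected F (M x)) x) (gradient (expected F (M y)) y)
        \<le> dist (gradient (expected F (M x)) x) (gradient (expected F (M y)) x)
          + dist (gradient (expected F (M y)) x) (gradient (expected F (M y)) y)"
      by (rule dist_triangle)
    also have "\<dots> \<le> b * (\<tau> * norm (x - y)) + c * dist x y"
      using gradient_expected_gap[OF wd lip(1) b W]
        lipschitz_onD[OF expected_gradient_lipschitz[OF wd prob lip(2)]]
      by (intro add_mono) (auto simp: dist_norm)
    finally show "dist (gradient (expected F (M x)) x) (gradient (expected F (M y)) y) \<le> (b * \<tau> + c) * dist x y"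
      by (simp add: dist_norm algebra_simps)
  qed (use b \<tau> lipschitz_on_nonneg[OF lip(2)] in simp)
qed

theorem theorem5:
  fixes K :: "'h::{real_inner,complete_space} \<Rightarrow> 'k::{real_inner,complete_space}"
    and mp :: "'h \<Rightarrow> 'a::polish_space measure"
    and md :: "'k \<Rightarrow> 'b::polish_space measure"
    and f :: "'h \<Rightarrow> 'a \<Rightarrow> real" and g :: "'h \<Rightarrow> real"
    and r :: "'k \<Rightarrow> 'b \<Rightarrow> real" and h :: "'k \<Rightarrow> real"
    and \<beta>f \<beta>r Lf Lr \<mu>p \<mu>d \<tau> \<mu> \<beta> \<rho> t0 :: real
    and xbar :: 'h and ybar :: 'k
    and L :: "'h \<Rightarrow> 'k \<Rightarrow> real"
    and Z :: "real \<Rightarrow> 'h \<times> 'k"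
  assumes K: "bounded_linear K"
    and mp: "\<And>x. prob_space (mp x)" "\<And>x. sets (mp x) = sets borel"
    and md: "\<And>y. prob_space (md y)" "\<And>y. sets (md y) = sets borel"
    and pos: "\<beta>f > 0" "\<beta>r > 0" "Lf > 0" "Lr > 0" "\<mu>p > 0" "\<mu>d > 0" "\<tau> > 0"
    and expectations: "expectations_well_defined f mp" "expectations_well_defined r md"
    and f: "C1_param f"
      "\<And>x. f x \<in> borel_measurable (mp x)"
      "\<And>x. \<beta>f-lipschitz_on UNIV (\<lambda>\<xi>. grad1 f x \<xi>)"
      "\<And>\<xi>. Lf-lipschitz_on UNIV (\<lambda>x. grad1 f x \<xi>)"
    and r: "C1_param r"
      "\<And>y. r y \<in> borel_measurable (md y)"
      "\<And>y. \<beta>r-lipschitz_on UNIV (\<lambda>\<zeta>. grad1 r y \<zeta>)"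
      "\<And>\<zeta>. Lr-lipschitz_on UNIV (\<lambda>y. grad1 r y \<zeta>)"
    and g: "(\<lambda>x. ereal (g x)) \<in> Gamma0" "C1 g" "\<exists>C. C-lipschitz_on UNIV (gradient g)"
    and h: "(\<lambda>y. ereal (h y)) \<in> Gamma0" "C1 h" "\<exists>C. C-lipschitz_on UNIV (gradient h)"
    and strong: "\<And>x. strongly_convex \<mu>p (\<lambda>z. expected f (mp x) z + g z)"
      "\<And>y. strongly_convex \<mu>d (\<lambda>w. expected r (md y) w + h w)"
    and W1: "\<And>x x' y y'. W1 (mp x \<Otimes>\<^sub>M md y) (mp x' \<Otimes>\<^sub>M md y')
               \<le> ereal (\<tau> * norm ((x, y) - (x', y')))"
    and \<mu>: "\<mu> = min \<mu>p \<mu>d"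
    and \<beta>: "\<beta> = max \<beta>f \<beta>r"
    and \<rho>: "\<rho> = \<tau> * \<beta> / \<mu>" "\<rho> < sqrt 2 / 4"
    and equilibrium: "is_equilibrium f g K h r mp md (xbar, ybar)"
    and L: "L = lagrangian f g K h r (mp xbar) (md ybar)"
    and solution: "is_solution \<mu> L (gap f r mp md (xbar, ybar)) t0 Z"
  shows "\<forall>t\<ge>t0.
     \<mu> / 2 * (norm (Z t - (xbar, ybar)))\<^sup>2 \<le> L (fst (Z t)) ybar - L xbar (snd (Z t)) \<and>
     L (fst (Z t)) ybar - L xbar (snd (Z t))
       \<le> energy \<mu> L (xbar, ybar) t0 Z t0 * exp (- (sqrt \<mu> / 4) * (t - t0))"
proof (intro allI impI)
  fix t assume t: "t0 \<le> t"
  have pos': "0 < \<mu>" "0 < \<beta>" "\<mu> \<le> \<mu>p" "\<mu> \<le> \<mu>d" "\<beta>f \<le> \<beta>" "\<beta>r \<le> \<beta>"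
    using pos \<mu> \<beta> by auto
  have \<rho>_nonneg: "0 \<le> \<rho>" using pos pos' \<rho>(1) by simp
  \<comment> \<open>The bound \<open>3 / 4\<close> is the one that leaves the rate
    \<open>1 / 4\<close>.\<close>
  have "sqrt 2 / 4 \<le> 3 / 4"
    using real_sqrt_le_mono[of 2 9] by simp
  then have \<rho>_le: "\<rho> \<le> 3 / 4" using \<rho>(2) by linarith
  have \<rho>\<mu>: "\<rho> * \<mu> = \<tau> * \<beta>" using \<rho>(1) pos' by simp

  \<comment> \<open>With equal second arguments the product norm is the norm of the first component;
    the value 0 is an arbitrary choice.\<close>
  have Wp: "W1 (mp x) (mp x') \<le> ereal (\<tau> * norm (x - x'))" for x x'
    using order_trans[OF W1_le_W1_pair_fst[OF md(1)] W1[of x 0 x' 0]] by (simp add: norm_prod_def)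
  have Wd: "W1 (md y) (md y') \<le> ereal (\<tau> * norm (y - y'))" for y y'
    using order_trans[OF W1_le_W1_pair_snd[OF mp(1) md(1) md(1)] W1[of 0 y 0 y']] by (simp add: norm_prod_def)

  define \<Phi> where "\<Phi> x = expected f (mp xbar) x + g x" for x
  define \<Psi> where "\<Psi> y = expected r (md ybar) y + h y" for y
  define \<Phi>' where "\<Phi>' x = gradient (expected f (mp xbar)) x + gradient g x" for x
  define \<Psi>' where "\<Psi>' y = gradient (expected r (md ybar)) y + gradient h y" for y
  have g': "GDERIV g x :> gradient g x" for x
    using g(2) GDERIV_gradient unfolding C1_def by blast
  have h': "GDERIV h y :> gradient h y" for y
    using h(2) GDERIV_gradient unfolding C1_def by blast
  have \<Phi>: "GDERIV \<Phi> x :> \<Phi>' x" for x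
    unfolding \<Phi>_def \<Phi>'_def by (intro GDERIV_add expected_GDERIV(1) expectations g')
  have \<Psi>: "GDERIV \<Psi> y :> \<Psi>' y" for y
    unfolding \<Psi>_def \<Psi>'_def by (intro GDERIV_add expected_GDERIV(1) expectations h')
  have \<Phi>c: "continuous_on UNIV \<Phi>'"
    unfolding \<Phi>'_def using g(2) lipschitz_on_continuous_on[OF expected_gradient_lipschitz[OF expectations(1) mp(1) f(4)]]
    by (intro continuous_on_add) (auto simp: C1_def)
  have \<Psi>c: "continuous_on UNIV \<Psi>'"
    unfolding \<Psi>'_def using h(2) lipschitz_on_continuous_on[OF expected_gradient_lipschitz[OF expectations(2) md(1) r(4)]]
    by (intro continuous_on_add) (auto simp: C1_def)
  have \<Phi>sc: "\<Phi> x + \<Phi>' x \<bullet> (y - x) + \<mu> / 2 * (norm (y - x))\<^sup>2 \<le> \<Phi> y" for x y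
  proof -
    have "\<Phi> x + \<Phi>' x \<bullet> (y - x) + \<mu>p / 2 * (norm (y - x))\<^sup>2 \<le> \<Phi> y"
      using strong(1)[of xbar] \<Phi> by (intro strongly_convex_above_gradient) (auto simp: \<Phi>_def[abs_def])
    moreover have "\<mu> / 2 * (norm (y - x))\<^sup>2 \<le> \<mu>p / 2 * (norm (y - x))\<^sup>2"
      using pos' by (intro mult_right_mono) auto
    ultimately show ?thesis by linarith
  qed
  have \<Psi>sc: "\<Psi> x + \<Psi>' x \<bullet> (y - x) + \<mu> / 2 * (norm (y - x))\<^sup>2 \<le> \<Psi> y" for x y
  proof -
    have "\<Psi> x + \<Psi>' x \<bullet> (y - x) + \<mu>d / 2 * (norm (y - x))\<^sup>2 \<le> \<Psi> y"
      using strong(2)[of ybar] \<Psi> by (intro strongly_convex_above_gradient) (auto simp: \<Psi>_def[abs_def])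
    moreover have "\<mu> / 2 * (norm (y - x))\<^sup>2 \<le> \<mu>d / 2 * (norm (y - x))\<^sup>2"
      using pos' by (intro mult_right_mono) auto
    ultimately show ?thesis by linarith
  qed

  obtain p q where p: "p \<in> subdifferential (\<lambda>z. ereal (g z)) xbar"
      "gradient (expected f (mp xbar)) xbar + p + adjoint K ybar = 0"
    and q: "q \<in> subdifferential (\<lambda>z. ereal (h z)) ybar"
      "gradient (expected r (md ybar)) ybar + q - K xbar = 0"
    using equilibrium unfolding is_equilibrium_def by auto
  have saddle: "\<Phi>' xbar + adjoint K ybar = 0" "\<Psi>' ybar - K xbar = 0"
    using p(2) q(2) subdifferential_eq_gradient[OF p(1) g'] subdifferential_eq_gradient[OF q(1) h']
    by (simp_all add: \<Phi>'_def \<Psi>'_def)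

  define E where "E = gap f r mp md (xbar, ybar)"
  have E_eq: "E z = (gradient (expected f (mp (fst z))) (fst z) - gradient (expected f (mp xbar)) (fst z),
      gradient (expected r (md (snd z))) (snd z) - gradient (expected r (md ybar)) (snd z))" for z
    by (simp add: E_def gap_def case_prod_unfold)
  have E_cont: "continuous_on UNIV E"
  proof -
    have f': "continuous_on UNIV (\<lambda>x. gradient (expected f (mp x)) x)"
        "continuous_on UNIV (gradient (expected f (mp xbar)))"
      using continuous_gradient_expected_diagonal[OF expectations(1) mp(1) f(3,4) pos(1) Wp] pos
        lipschitz_on_continuous_on[OF expected_gradient_lipschitz[OF expectations(1) mp(1) f(4)]] by auto
    have r': "continuous_on UNIV (\<lambda>y. gradient (expected r (md y)) y)"
        "continuous_on UNIV (gradient (expected r (md ybar)))"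
      using continuous_gradient_expected_diagonal[OF expectations(2) md(1) r(3,4) pos(2) Wd] pos
        lipschitz_on_continuous_on[OF expected_gradient_lipschitz[OF expectations(2) md(1) r(4)]] by auto
    show ?thesis
      unfolding E_eq[abs_def]
      by (intro continuous_on_Pair continuous_on_diff continuous_on_compose2[OF f'(1), of _ fst]
          continuous_on_compose2[OF f'(2), of _ fst] continuous_on_compose2[OF r'(1), of _ snd]
          continuous_on_compose2[OF r'(2), of _ snd] continuous_on_fst continuous_on_snd continuous_on_id) auto
  qed
  have E_le: "norm (E z) \<le> \<rho> * \<mu> * norm (z - (xbar, ybar))" for z
  proof -
    have f': "norm (fst (E z)) \<le> \<rho> * \<mu> * norm (fst z - xbar)"
    proof -
      have "norm (fst (E z)) \<le> \<beta>f * (\<tau> * norm (fst z - xbar))"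
        using gradient_expected_gap[OF expectations(1) f(3) pos(1) Wp] by (simp add: E_eq)
      also have "\<dots> \<le> \<beta> * (\<tau> * norm (fst z - xbar))"
        using pos pos' by (intro mult_right_mono) auto
      finally show ?thesis unfolding \<rho>\<mu> by (simp add: ac_simps)
    qed
    have r': "norm (snd (E z)) \<le> \<rho> * \<mu> * norm (snd z - ybar)"
    proof -
      have "norm (snd (E z)) \<le> \<beta>r * (\<tau> * norm (snd z - ybar))"
        using gradient_expected_gap[OF expectations(2) r(3) pos(2) Wd] by (simp add: E_eq)
      also have "\<dots> \<le> \<beta> * (\<tau> * norm (snd z - ybar))"
        using pos pos' by (intro mult_right_mono) auto
      finally show ?thesis unfolding \<rho>\<mu> by (simp add: ac_simps)
    qed
    \<comment> \<open>The components are bounded by their own displacements with the same constant,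
      so the squares add up to the product norm without an extra factor.\<close>
    have "norm (E z) \<le> sqrt ((\<rho> * \<mu> * norm (fst z - xbar))\<^sup>2 + (\<rho> * \<mu> * norm (snd z - ybar))\<^sup>2)"
      unfolding norm_prod_def using f' r' by (intro real_sqrt_le_mono add_mono power_mono) auto
    also have "\<dots> = sqrt ((\<rho> * \<mu>)\<^sup>2 * (norm (z - (xbar, ybar)))\<^sup>2)"
      by (simp add: norm_prod_def power_mult_distrib distrib_left)
    also have "\<dots> = \<rho> * \<mu> * norm (z - (xbar, ybar))"
      using \<rho>_nonneg pos' by (simp add: real_sqrt_mult)
    finally show ?thesis .
  qed
  have L': "L x y = \<Phi> x + y \<bullet> K x - \<Psi> y" for x y
    by (simp add: L lagrangian_def \<Phi>_def \<Psi>_def)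
  show "\<mu> / 2 * (norm (Z t - (xbar, ybar)))\<^sup>2 \<le> L (fst (Z t)) ybar - L xbar (snd (Z t)) \<and>
     L (fst (Z t)) ybar - L xbar (snd (Z t))
       \<le> energy \<mu> L (xbar, ybar) t0 Z t0 * exp (- (sqrt \<mu> / 4) * (t - t0))"
    using saddle_flow_decay[OF K pos'(1) \<rho>_nonneg \<rho>_le \<Phi> \<Phi>c \<Phi>sc \<Psi> \<Psi>c \<Psi>sc saddle E_cont E_le L'
        solution[folded E_def] t] by blast
qed

end
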